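(* Let $P$ be a non-empty set of primes and let $G$ be an elementary amenable $P$-torsion group. Then the homology groups $H_n(G,\mathbb{Z})$, $n\geq 1$, are $P$-torsion.
   Context: For a non-empty set of primes $P$, a $P$-torsion group is a group $G$ such that for every $x\in G$ there exists $p\in P$ such that $x$ is $p$-torsion (that is, the order of $x$ is a power of $p$). The class of elementary amenable groups is the smallest class of groups that contains abelian and finite groups and is closed under isomorphisms, subgroups, quotients, extensions and directed unions.
   Formalization: Here P-torsion means every element has finite order with all prime factors in P, not order a power of a single p in P; with the latter the claim fails: S_3 is {2,3}-torsion, but H_3(S_3,Z)=Z/6. For P={p} both agree. *)

theory Defs
  imports "HOL-Algebra.Free_Abelian_Groups" "HOL-Algebra.Multiplicative_Group"
    "HOL-Computational_Algebra.Primes"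
begin

text \<open>
  An element is \<open>P\<close>-torsion if its order is a finite product of powers of primes in \<open>P\<close>.
  The stricter condition that the order of every element is a power of a \<^emph>\<open>single\<close>
  prime in \<open>P\<close> is not inherited by homology: all elements of the symmetric group \<open>S\<^sub>3\<close> have
  order 1, 2 or 3, but \<open>H\<^sub>3(S\<^sub>3, \<int>)\<close> is cyclic of order 6. The stricter condition
  implies the one used here (lemma \<open>P_torsion_group_if_prime_power_orders\<close>), and for
  singletons \<open>P\<close> the two coincide (lemma \<open>P_torsion_group_singleton\<close>).

  Elements of infinite order have \<open>group.ord G x = 0\<close>.
\<close>

definition P_torsion_group :: "nat set \<Rightarrow> ('a, 'b) monoid_scheme \<Rightarrow> bool" where
  "P_torsion_group P G \<longleftrightarrow>
     group G \<and>
     (\<forall>x\<in>carrier G. group.ord G x \<noteq> 0 \<and> prime_factors (group.ord G x) \<subseteq> P)"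

lemma P_torsion_group_if_prime_power_orders:
  assumes "group G" and "\<forall>p\<in>P. prime p"
    and "\<forall>x\<in>carrier G. \<exists>p\<in>P. \<exists>k. group.ord G x = p ^ k"
  shows "P_torsion_group P G"
  unfolding P_torsion_group_def
proof (intro conjI ballI)
  fix x assume "x \<in> carrier G"
  then obtain p k where pk: "p \<in> P" "group.ord G x = p ^ k" using assms(3) by blast
  have p: "prime p" using pk(1) assms(2) by blast
  show "group.ord G x \<noteq> 0" using pk p by (simp add: prime_gt_0_nat)
  show "prime_factors (group.ord G x) \<subseteq> P"
  proof
    fix q assume "q \<in> prime_factors (group.ord G x)"
    then have "prime q" "q dvd p ^ k" using pk(2) by (auto simp: in_prime_factors_iff)
    then have "q = p" using p by (meson prime_dvd_power primes_dvd_imp_eq)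
    then show "q \<in> P" using pk(1) by simp
  qed
qed (rule assms(1))

lemma P_torsion_group_singleton:
  assumes "prime p"
  shows "P_torsion_group {p} G \<longleftrightarrow>
    group G \<and> (\<forall>x\<in>carrier G. \<exists>k. group.ord G x = p ^ k)"
proof
  assume G: "P_torsion_group {p} G"
  have "\<exists>k. group.ord G x = p ^ k" if "x \<in> carrier G" for x
  proof -
    let ?m = "group.ord G x"
    have m: "?m \<noteq> 0" "prime_factors ?m \<subseteq> {p}"
      using G that unfolding P_torsion_group_def by auto
    have "?m = (\<Prod>q\<in>prime_factors ?m. q ^ multiplicity q ?m)"
      using m(1) by (simp add: prime_factorization_nat)
    also have "\<dots> = (\<Prod>q\<in>{p}. q ^ multiplicity q ?m)"
      using m assms
      by (intro prod.mono_neutral_left)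
         (auto simp: in_prime_factors_iff not_dvd_imp_multiplicity_0)
    finally show ?thesis by auto
  qed
  then show "group G \<and> (\<forall>x\<in>carrier G. \<exists>k. group.ord G x = p ^ k)"
    using G unfolding P_torsion_group_def by blast
next
  assume "group G \<and> (\<forall>x\<in>carrier G. \<exists>k. group.ord G x = p ^ k)"
  then show "P_torsion_group {p} G"
    using assms by (intro P_torsion_group_if_prime_power_orders) auto
qed

text \<open>
  The class is formed inside the universe of groups with elements in a fixed type \<open>'a\<close>;
  quotients, which live on cosets, are brought back to \<open>'a\<close> by an isomorphism. No group on \<open>'a\<close>
  is lost in this way. Let \<open>C\<close> be a class of groups on \<open>'a\<close> with the closure
  properties below. The groups \<open>K\<close> on arbitrary types such that \<open>C\<close> contains every group
  on \<open>'a\<close> isomorphic to a subquotient of \<open>K\<close> form a class that contains the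
  abelian and the finite groups and is closed under isomorphisms, subgroups, quotients,
  extensions and directed unions, as a subquotient of an extension (directed union) is an
  extension (directed union) of subquotients of no larger cardinality. So this class
  contains all elementary amenable groups, and those on \<open>'a\<close> belong to \<open>C\<close>.
\<close>

inductive elementary_amenable :: "'a monoid \<Rightarrow> bool" where
  abelian: "comm_group G \<Longrightarrow> elementary_amenable G"
| finite: "\<lbrakk>group G; finite (carrier G)\<rbrakk> \<Longrightarrow> elementary_amenable G"
| isomorphic: "\<lbrakk>elementary_amenable G; group H; G \<cong> H\<rbrakk> \<Longrightarrow> elementary_amenable H"
| subgroup: "\<lbrakk>elementary_amenable G; subgroup H G\<rbrakk>
    \<Longrightarrow> elementary_amenable (G\<lparr>carrier := H\<rparr>)"
| quotient: "\<lbrakk>elementary_amenable G; N \<lhd> G; group Q; G Mod N \<cong> Q\<rbrakk>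
    \<Longrightarrow> elementary_amenable Q"
| extension: "\<lbrakk>group G; N \<lhd> G; elementary_amenable (G\<lparr>carrier := N\<rparr>);
      G Mod N \<cong> Q; elementary_amenable Q\<rbrakk>
    \<Longrightarrow> elementary_amenable G"
| directed_union: "\<lbrakk>group G; \<H> \<noteq> {};
      \<And>H. H \<in> \<H> \<Longrightarrow> subgroup H G;
      \<And>H. H \<in> \<H> \<Longrightarrow> elementary_amenable (G\<lparr>carrier := H\<rparr>);
      \<And>H K. \<lbrakk>H \<in> \<H>; K \<in> \<H>\<rbrakk> \<Longrightarrow> \<exists>L\<in>\<H>. H \<subseteq> L \<and> K \<subseteq> L;
      carrier G = \<Union>\<H>\<rbrakk>
    \<Longrightarrow> elementary_amenable G"

text \<open>
  \<open>H\<^sub>n(G, \<int>)\<close> is the homology of the bar complex \<open>\<int> \<otimes>\<^bsub>\<int>G\<^esub> B\<^sub>*\<close>, where \<open>B\<^sub>*\<close> is the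
  (unnormalised) bar resolution of \<open>\<int>\<close>. Its \<open>n\<close>-chains are the free abelian group on the
  symbols \<open>[g\<^sub>1|\<dots>|g\<^sub>n]\<close>, represented by lists over \<open>carrier G\<close>. The list \<open>bar_face G i xs\<close>
  is the \<open>i\<close>-th face for \<open>0 \<le> i \<le> n\<close>; the factor \<open>g\<^sub>1\<close> that the outer face
  \<open>i = 0\<close> splits off acts trivially on \<open>\<int>\<close>.
\<close>

definition bar_face :: "('a, 'b) monoid_scheme \<Rightarrow> nat \<Rightarrow> 'a list \<Rightarrow> 'a list" where
  "bar_face G i xs =
     (if i = 0 then tl xs
      else if i = length xs then butlast xs
      else take (i - 1) xs @ [xs ! (i - 1) \<otimes>\<^bsub>G\<^esub> xs ! i] @ drop (i + 1) xs)"

definition bar_chain_group ::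
  "nat \<Rightarrow> ('a, 'b) monoid_scheme \<Rightarrow> ('a list \<Rightarrow>\<^sub>0 int) monoid" where
  "bar_chain_group n G = free_Abelian_group {xs. length xs = n \<and> set xs \<subseteq> carrier G}"

definition bar_boundary ::
  "nat \<Rightarrow> ('a, 'b) monoid_scheme \<Rightarrow> ('a list \<Rightarrow>\<^sub>0 int) \<Rightarrow> ('a list \<Rightarrow>\<^sub>0 int)" where
  "bar_boundary n G c =
     (if n = 0 then 0
      else frag_extend (\<lambda>xs. \<Sum>i\<le>n. frag_cmul ((-1) ^ i) (frag_of (bar_face G i xs))) c)"

definition bar_cycles :: "nat \<Rightarrow> ('a, 'b) monoid_scheme \<Rightarrow> ('a list \<Rightarrow>\<^sub>0 int) set" where
  "bar_cycles n G = {c \<in> carrier (bar_chain_group n G). bar_boundary n G c = 0}"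

definition bar_boundaries :: "nat \<Rightarrow> ('a, 'b) monoid_scheme \<Rightarrow> ('a list \<Rightarrow>\<^sub>0 int) set" where
  "bar_boundaries n G = bar_boundary (Suc n) G ` carrier (bar_chain_group (Suc n) G)"

definition group_homology ::
  "nat \<Rightarrow> ('a, 'b) monoid_scheme \<Rightarrow> ('a list \<Rightarrow>\<^sub>0 int) set monoid" where
  "group_homology n G = (bar_chain_group n G)\<lparr>carrier := bar_cycles n G\<rparr> Mod bar_boundaries n G"

end

theory Submission
  imports Defs "HOL-Algebra.Sylow"
begin

text \<open>
  A torsion elementary amenable group is locally finite. Abelian torsion groups and finite
  groups are locally finite, and local finiteness is inherited by subgroups, quotients,
  extensions and directed unions. To run an induction over the class of elementary
  amenable groups, in which groups with elements of infinite order occur, the claim is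
  strengthened: in every elementary amenable group, every torsion quotient of a subgroup is locally
  finite (lemma \<open>elementary_amenable_torsion_sections_locally_finite\<close>).

  For \<open>n \<ge> 1\<close>, a cycle in the bar complex of \<open>G\<close> involves only finitely many elements of \<open>G\<close>. If \<open>G\<close> is
  locally finite, these lie in a finite subgroup \<open>K\<close>. Summing over all ways to append an
  element of \<open>K\<close> to a bar symbol is, up to sign, a chain homotopy from multiplication by the order
  of \<open>K\<close> to zero in positive degrees (lemma \<open>bar_boundary_append_sum\<close>), so the order of \<open>K\<close>
  annihilates the homology class of the cycle. If \<open>G\<close> is \<open>P\<close>-torsion, all prime factors of the order of \<open>K\<close> are in \<open>P\<close> by Cauchy's
  theorem (lemma \<open>prime_factors_finite_subgroup_of_P_torsion\<close>).
\<close>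

section \<open>Local finiteness of torsion sections\<close>

text \<open>
  A section of \<open>G\<close> is a quotient \<open>H/M\<close> of a subgroup \<open>H\<close>. It is encoded by the pair
  \<open>(H, M)\<close> and never formed as a group of cosets. In this way all sections of all groups
  considered are pairs of subsets of one type, and the pairs can be intersected with a
  subgroup or moved along a homomorphism.
\<close>

definition torsion_section :: "('a, 'b) monoid_scheme \<Rightarrow> 'a set \<Rightarrow> 'a set \<Rightarrow> bool" where
  "torsion_section G H M \<longleftrightarrow> subgroup H G \<and> subgroup M G \<and> M \<subseteq> H \<and>
     (\<forall>h\<in>H. \<forall>m\<in>M. inv\<^bsub>G\<^esub> h \<otimes>\<^bsub>G\<^esub> m \<otimes>\<^bsub>G\<^esub> h \<in> M) \<and>
     (\<forall>h\<in>H. \<exists>k>0. h [^]\<^bsub>G\<^esub> (k::nat) \<in> M)"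

text \<open>
  For \<open>M\<close> normal in \<open>H\<close>, this is local finiteness of \<open>H/M\<close>. Left multiplication by
  \<open>s \<in> S\<close> maps the finite set \<open>FM/M\<close> injectively into itself, hence permutes it, so the
  subgroup generated by \<open>S\<close> modulo \<open>M\<close> also permutes \<open>FM/M\<close>; as \<open>F\<close> contains \<open>\<one>\<close>, that subgroup
  is contained in \<open>FM/M\<close>.
  A set \<open>F\<close> that is only closed under \<open>S\<close> is easier to construct than a finite subgroup.
\<close>

definition locally_finite_mod :: "('a, 'b) monoid_scheme \<Rightarrow> 'a set \<Rightarrow> 'a set \<Rightarrow> bool" where
  "locally_finite_mod G H M \<longleftrightarrow>
     (\<forall>S. finite S \<longrightarrow> S \<subseteq> H \<longrightarrow>
       (\<exists>F. finite F \<and> F \<subseteq> H \<and> \<one>\<^bsub>G\<^esub> \<in> F \<and>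
         (\<forall>s\<in>S. \<forall>f\<in>F. \<exists>f'\<in>F. \<exists>m\<in>M. s \<otimes>\<^bsub>G\<^esub> f = f' \<otimes>\<^bsub>G\<^esub> m)))"

text \<open>
  Local finiteness of the torsion group \<open>G\<close> alone cannot be carried through an induction over
  the class of elementary amenable groups: a torsion group may arise as a quotient of a group
  with elements of infinite order. Quantifying over all torsion sections makes the property
  pass to subgroups and quotients.
\<close>

definition torsion_sections_locally_finite :: "('a, 'b) monoid_scheme \<Rightarrow> bool" where
  "torsion_sections_locally_finite G \<longleftrightarrow>
     group G \<and> (\<forall>H M. torsion_section G H M \<longrightarrow> locally_finite_mod G H M)"

lemma locally_finite_modE:
  assumes "locally_finite_mod G H M" "finite S" "S \<subseteq> H"
  obtains F where "finite F" "F \<subseteq> H" "\<one>\<^bsub>G\<^esub> \<in> F"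
    "\<And>s f. s \<in> S \<Longrightarrow> f \<in> F \<Longrightarrow> \<exists>f'\<in>F. \<exists>m\<in>M. s \<otimes>\<^bsub>G\<^esub> f = f' \<otimes>\<^bsub>G\<^esub> m"
  using assms unfolding locally_finite_mod_def by meson

lemma locally_finite_mod_restrict:
  "locally_finite_mod (G\<lparr>carrier := K\<rparr>) H M \<longleftrightarrow> locally_finite_mod G H M"
  by (simp add: locally_finite_mod_def)

lemma (in group) torsion_section_restrict:
  assumes K: "subgroup K G"
  shows "torsion_section (G\<lparr>carrier := K\<rparr>) H M \<longleftrightarrow> torsion_section G H M \<and> H \<subseteq> K"
proof -
  have sub: "subgroup I (G\<lparr>carrier := K\<rparr>) \<longleftrightarrow> subgroup I G \<and> I \<subseteq> K" for I
    using incl_subgroup[OF K] subgroup_incl[OF _ K] subgroup.subset by fastforce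
  have "inv\<^bsub>G\<lparr>carrier := K\<rparr>\<^esub> h = inv h" if "H \<subseteq> K" "h \<in> H" for h
    using K that by auto
  then show ?thesis
    unfolding torsion_section_def sub nat_pow_consistent[of _ _ K, symmetric]
    by auto
qed

lemma (in group) torsion_section_Int:
  assumes "torsion_section G H M" and K: "subgroup K G"
  shows "torsion_section G (H \<inter> K) (M \<inter> K)"
proof -
  have "inv h \<otimes> m \<otimes> h \<in> K" if "h \<in> K" "m \<in> K" for h m
    using that K by (simp add: subgroup.m_closed subgroup.m_inv_closed)
  moreover have "h [^] (k::nat) \<in> K" if "h \<in> K" for h k
    using that K by (induction k) (auto simp: subgroup.one_closed subgroup.m_closed)
  ultimately show ?thesis
    using assms subgroups_Inter_pair
    unfolding torsion_section_def by (auto 0 3)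
qed

lemma (in group) torsion_sections_locally_finite_restrict:
  assumes "torsion_sections_locally_finite (G\<lparr>carrier := K\<rparr>)" "subgroup K G"
    and "torsion_section G H M"
  shows "locally_finite_mod G (H \<inter> K) (M \<inter> K)"
  using assms torsion_section_Int torsion_section_restrict
  unfolding torsion_sections_locally_finite_def by (metis inf_le2 locally_finite_mod_restrict)

lemma (in group_hom) torsion_section_image:
  assumes "torsion_section G I M"
  shows "torsion_section H (h ` I) (h ` M)"
proof -
  note S = assms[unfolded torsion_section_def]
  have I: "x \<in> carrier G" if "x \<in> I" for x
    using S that subgroup.mem_carrier by metis
  have M: "x \<in> carrier G" if "x \<in> M" for x
    using S that subgroup.mem_carrier by metis
  have "inv\<^bsub>H\<^esub> h x \<otimes>\<^bsub>H\<^esub> h m \<otimes>\<^bsub>H\<^esub> h x \<in> h ` M" if "x \<in> I" "m \<in> M" for x m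
  proof -
    have "h (inv x \<otimes> m \<otimes> x) = inv\<^bsub>H\<^esub> h x \<otimes>\<^bsub>H\<^esub> h m \<otimes>\<^bsub>H\<^esub> h x"
      using I M that by simp
    then show ?thesis using S that by (metis imageI)
  qed
  moreover have "\<exists>k>0. h x [^]\<^bsub>H\<^esub> (k::nat) \<in> h ` M" if "x \<in> I" for x
    using S I that by (metis hom_nat_pow imageI)
  ultimately show ?thesis
    using S subgroup_img_is_subgroup unfolding torsion_section_def by auto
qed

lemma (in group_hom) torsion_section_vimage:
  assumes "torsion_section H I M"
  shows "torsion_section G (h -` I \<inter> carrier G) (h -` M \<inter> carrier G)"
proof -
  note S = assms[unfolded torsion_section_def]
  have sub: "subgroup (h -` J \<inter> carrier G) G" if "subgroup J H" for J
  proof (rule G.subgroupI)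
    have "\<one> \<in> h -` J \<inter> carrier G" using subgroup.one_closed[OF that] by simp
    then show "h -` J \<inter> carrier G \<noteq> {}" by blast
  qed (use that in \<open>auto simp: subgroup.m_closed subgroup.m_inv_closed\<close>)
  show ?thesis
    using S sub unfolding torsion_section_def by (auto simp: hom_nat_pow)
qed

text \<open>
  A torsion section of the image is, up to isomorphism, the section formed by the preimages.
\<close>

lemma (in group_hom) torsion_sections_locally_finite_image:
  assumes G: "torsion_sections_locally_finite G" and surj: "h ` carrier G = carrier H"
  shows "torsion_sections_locally_finite H"
  unfolding torsion_sections_locally_finite_def locally_finite_mod_def
proof (intro conjI allI impI)
  fix I M S assume IM: "torsion_section H I M" and S: "finite S" "S \<subseteq> I"
  let ?I = "h -` I \<inter> carrier G" and ?M = "h -` M \<inter> carrier G"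
  have "I \<subseteq> carrier H" using IM subgroup.subset unfolding torsion_section_def by blast
  then obtain T where T: "T \<subseteq> carrier G" "finite T" "S = h ` T"
    using S surj by (metis finite_subset_image subset_trans)
  have "locally_finite_mod G ?I ?M"
    using torsion_section_vimage[OF IM] G unfolding torsion_sections_locally_finite_def by blast
  moreover have "T \<subseteq> ?I" using T S by blast
  ultimately obtain F where F: "finite F" "F \<subseteq> ?I" "\<one> \<in> F"
    "\<And>s f. s \<in> T \<Longrightarrow> f \<in> F \<Longrightarrow> \<exists>f'\<in>F. \<exists>m\<in>?M. s \<otimes> f = f' \<otimes> m"
    using T(2) by (metis locally_finite_modE)
  have "\<exists>f'\<in>h ` F. \<exists>m\<in>M. h s \<otimes>\<^bsub>H\<^esub> h f = f' \<otimes>\<^bsub>H\<^esub> m" if s: "s \<in> T" and f: "f \<in> F" for s f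
  proof -
    obtain f' m where fm: "f' \<in> F" "m \<in> ?M" "s \<otimes> f = f' \<otimes> m" using F(4)[OF s f] by blast
    have "h s \<otimes>\<^bsub>H\<^esub> h f = h (s \<otimes> f)" using s f T F by (auto intro!: hom_mult[symmetric])
    also have "\<dots> = h f' \<otimes>\<^bsub>H\<^esub> h m" unfolding fm(3) using fm F by (auto intro!: hom_mult)
    finally show ?thesis using fm by blast
  qed
  moreover have "\<one>\<^bsub>H\<^esub> \<in> h ` F" using F(3) hom_one by (metis imageI)
  ultimately show "\<exists>F. finite F \<and> F \<subseteq> I \<and> \<one>\<^bsub>H\<^esub> \<in> F \<and>
      (\<forall>s\<in>S. \<forall>f\<in>F. \<exists>f'\<in>F. \<exists>m\<in>M. s \<otimes>\<^bsub>H\<^esub> f = f' \<otimes>\<^bsub>H\<^esub> m)"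
    using F(1,2) unfolding T(3) by (intro exI[of _ "h ` F"]) auto
qed (rule H.is_group)

text \<open>
  A finitely generated abelian torsion group is finite: if \<open>F\<close> serves for \<open>S\<close> and
  \<open>x\<^sup>k \<in> M\<close>, the products \<open>x\<^sup>i f\<close> with \<open>i < k\<close> and \<open>f \<in> F\<close> serve for \<open>S \<union> {x}\<close>.
\<close>

lemma (in comm_group) torsion_sections_locally_finite_abelian: "torsion_sections_locally_finite G"
  unfolding torsion_sections_locally_finite_def locally_finite_mod_def
proof (intro conjI allI impI)
  fix H M S assume HM: "torsion_section G H M" and "finite S" "S \<subseteq> H"
  note D = HM[unfolded torsion_section_def]
  interpret H: subgroup H G using D by blast
  interpret M: subgroup M G using D by blast
  have H_pow: "h [^] (k::nat) \<in> H" if "h \<in> H" for h k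
    using that by (induction k) auto
  from \<open>finite S\<close> \<open>S \<subseteq> H\<close> show "\<exists>F. finite F \<and> F \<subseteq> H \<and> \<one> \<in> F \<and>
      (\<forall>s\<in>S. \<forall>f\<in>F. \<exists>f'\<in>F. \<exists>m\<in>M. s \<otimes> f = f' \<otimes> m)"
  proof (induction S)
    case empty
    show ?case by (intro exI[of _ "{\<one>}"]) auto
  next
    case (insert x S)
    then obtain F where F: "finite F" "F \<subseteq> H" "\<one> \<in> F"
      "\<And>s f. s \<in> S \<Longrightarrow> f \<in> F \<Longrightarrow> \<exists>f'\<in>F. \<exists>m\<in>M. s \<otimes> f = f' \<otimes> m"
      by auto
    have x: "x \<in> H" using insert by simp
    obtain k :: nat where k: "k > 0" "x [^] k \<in> M" using D x by blast
    let ?F = "(\<lambda>(i, f). x [^] i \<otimes> f) ` ({..<k} \<times> F)"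
    have car: "y \<in> carrier G" if "y \<in> F \<or> y \<in> S \<or> y = x \<or> y \<in> M" for y
      using that F insert.prems by auto
    have "\<exists>f'\<in>?F. \<exists>m\<in>M. s \<otimes> (x [^] i \<otimes> f) = f' \<otimes> m"
      if s: "s \<in> insert x S" and i: "i < k" and f: "f \<in> F" for s i f
    proof -
      have c: "s \<in> carrier G" "x \<in> carrier G" "f \<in> carrier G" using s f car by auto
      show ?thesis
      proof (cases "s = x")
        case False
        then obtain f' m where fm: "f' \<in> F" "m \<in> M" "s \<otimes> f = f' \<otimes> m" using F(4) s f by blast
        have "s \<otimes> (x [^] i \<otimes> f) = x [^] i \<otimes> (s \<otimes> f)" using c i by (simp add: m_lcomm)
        also have "\<dots> = (x [^] i \<otimes> f') \<otimes> m" using fm car by (simp add: m_assoc)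
        finally show ?thesis using fm i by (intro bexI[of _ "x [^] i \<otimes> f'"] bexI[of _ m]) auto
      next
        case True
        have *: "s \<otimes> (x [^] i \<otimes> f) = x [^] Suc i \<otimes> f"
          using True c by (simp add: m_assoc[symmetric] m_comm[of x "x [^] i"])
        show ?thesis
        proof (cases "Suc i < k")
          case True
          then have "x [^] Suc i \<otimes> f \<in> ?F" using f by (intro image_eqI[of _ _ "(Suc i, f)"]) auto
          then show ?thesis unfolding * using M.one_closed c by (metis r_one m_closed nat_pow_closed)
        next
          case False
          \<comment> \<open>The next power of \<open>x\<close> is in \<open>M\<close>, so the product is again represented by \<open>x\<^sup>0 f\<close>.\<close>
          then have "Suc i = k" using i by simp
          then have "s \<otimes> (x [^] i \<otimes> f) = (x [^] (0::nat) \<otimes> f) \<otimes> x [^] k"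
            using * c m_comm by simp
          moreover have "x [^] (0::nat) \<otimes> f \<in> ?F"
            using k(1) f by (intro image_eqI[of _ _ "(0, f)"]) auto
          ultimately show ?thesis using k(2) by blast
        qed
      qed
    qed
    moreover have "\<one> \<in> ?F" using F(3) k(1) by (intro image_eqI[of _ _ "(0, \<one>)"]) auto
    moreover have "?F \<subseteq> H" using F(2) x H_pow by auto
    ultimately show ?case using F(1) by (intro exI[of _ ?F]) auto
  qed
qed (rule is_group)

lemma (in group) torsion_sections_locally_finite_finite:
  assumes "finite (carrier G)"
  shows "torsion_sections_locally_finite G"
  unfolding torsion_sections_locally_finite_def locally_finite_mod_def
proof (intro conjI allI impI)
  fix H M S assume HM: "torsion_section G H M" and "finite S" and S: "S \<subseteq> H"
  note D = HM[unfolded torsion_section_def]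
  interpret H: subgroup H G using D by blast
  interpret M: subgroup M G using D by blast
  have "\<exists>f'\<in>H. \<exists>m\<in>M. s \<otimes> f = f' \<otimes> m" if "s \<in> S" "f \<in> H" for s f
    using that S by (intro bexI[of _ "s \<otimes> f"] bexI[of _ \<one>]) (auto intro!: r_one[symmetric])
  then show "\<exists>F. finite F \<and> F \<subseteq> H \<and> \<one> \<in> F \<and>
      (\<forall>s\<in>S. \<forall>f\<in>F. \<exists>f'\<in>F. \<exists>m\<in>M. s \<otimes> f = f' \<otimes> m)"
    using H.one_closed assms finite_subset[OF H.subset] by (intro exI[of _ H]) auto
qed (rule is_group)

text \<open>
  Finitely many elements lie in one member of a directed union.
\<close>

lemma (in group) torsion_sections_locally_finite_directed_union:
  assumes ne: "\<H> \<noteq> {}" and sub: "\<And>H. H \<in> \<H> \<Longrightarrow> subgroup H G"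
    and lf: "\<And>H. H \<in> \<H> \<Longrightarrow> torsion_sections_locally_finite (G\<lparr>carrier := H\<rparr>)"
    and dir: "\<And>H K. \<lbrakk>H \<in> \<H>; K \<in> \<H>\<rbrakk> \<Longrightarrow> \<exists>L\<in>\<H>. H \<subseteq> L \<and> K \<subseteq> L"
    and union: "carrier G = \<Union>\<H>"
  shows "torsion_sections_locally_finite G"
  unfolding torsion_sections_locally_finite_def locally_finite_mod_def
proof (intro conjI allI impI)
  fix H M S assume HM: "torsion_section G H M" and S: "finite S" "S \<subseteq> H"
  have "S \<subseteq> carrier G" using HM S subgroup.subset unfolding torsion_section_def by blast
  with S(1) have "\<exists>K\<in>\<H>. S \<subseteq> K"
  proof (induction S)
    case (insert x S)
    then obtain K L where "K \<in> \<H>" "S \<subseteq> K" "L \<in> \<H>" "x \<in> L" using union by auto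
    then show ?case using dir[of K L] by blast
  qed (use ne in auto)
  then obtain K where K: "K \<in> \<H>" "S \<subseteq> K" by blast
  have "locally_finite_mod G (H \<inter> K) (M \<inter> K)"
    using lf sub K(1) HM by (intro torsion_sections_locally_finite_restrict) auto
  then obtain F where "finite F" "F \<subseteq> H \<inter> K" "\<one> \<in> F"
    "\<And>s f. s \<in> S \<Longrightarrow> f \<in> F \<Longrightarrow> \<exists>f'\<in>F. \<exists>m\<in>M \<inter> K. s \<otimes> f = f' \<otimes> m"
    using S K(2) by (metis locally_finite_modE le_inf_iff)
  then show "\<exists>F. finite F \<and> F \<subseteq> H \<and> \<one> \<in> F \<and>
      (\<forall>s\<in>S. \<forall>f\<in>F. \<exists>f'\<in>F. \<exists>m\<in>M. s \<otimes> f = f' \<otimes> m)"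
    by (intro exI[of _ F]) blast
qed (rule is_group)

text \<open>
  A variant of Schreier's argument. A finite set \<open>F\<close> that is closed under \<open>S\<close> modulo \<open>M\<close> in the
  quotient lifts to the group, where it is closed up to correction factors \<open>c s f\<close> in the kernel:
  \<open>s f = f' (c s f) m\<close>. There are finitely many of these factors, so some finite subset \<open>L\<close> of the kernel
  is closed under them modulo \<open>M\<close>, and then the products \<open>f l\<close> with \<open>f \<in> F\<close> and
  \<open>l \<in> L\<close> are closed under \<open>S\<close> modulo \<open>M\<close>. Elements of \<open>M\<close> can always be moved to the right, as
  \<open>M\<close> is normalised.
\<close>

lemma (in group_hom) torsion_sections_locally_finite_extension:
  assumes Q: "torsion_sections_locally_finite H"
    and N: "torsion_sections_locally_finite (G\<lparr>carrier := kernel G H h\<rparr>)"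
  shows "torsion_sections_locally_finite G"
  unfolding torsion_sections_locally_finite_def locally_finite_mod_def
proof (intro conjI allI impI)
  fix I M S assume IM: "torsion_section G I M" and S: "finite S" "S \<subseteq> I"
  let ?N = "kernel G H h"
  note D = IM[unfolded torsion_section_def]
  interpret I: subgroup I G using D by blast
  interpret M: subgroup M G using D by blast
  have MI: "m \<in> I" if "m \<in> M" for m using D that by blast
  have swap: "\<exists>m'\<in>M. m \<otimes> n = n \<otimes> m'" if "m \<in> M" "n \<in> I" for m n
  proof (intro bexI)
    show "inv n \<otimes> m \<otimes> n \<in> M" using D that by blast
    show "m \<otimes> n = n \<otimes> (inv n \<otimes> m \<otimes> n)" using that by (simp add: G.m_assoc[symmetric])
  qed
  have "locally_finite_mod H (h ` I) (h ` M)"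
    using Q torsion_section_image[OF IM] unfolding torsion_sections_locally_finite_def by blast
  moreover have "h ` S \<subseteq> h ` I" using S by blast
  ultimately obtain E where E: "finite E" "E \<subseteq> h ` I" "\<one>\<^bsub>H\<^esub> \<in> E"
    "\<And>s f. s \<in> h ` S \<Longrightarrow> f \<in> E \<Longrightarrow> \<exists>f'\<in>E. \<exists>m\<in>h ` M. s \<otimes>\<^bsub>H\<^esub> f = f' \<otimes>\<^bsub>H\<^esub> m"
    using S(1) by (metis locally_finite_modE finite_imageI)
  obtain F where F0: "F \<subseteq> I" "finite F" "h ` F = E"
    using E(1,2) finite_subset_image by metis
  \<comment> \<open>The lift has to contain \<open>\<one>\<close> itself, not only some element of the kernel.\<close>
  define F1 where "F1 = insert \<one> F"
  have F: "F1 \<subseteq> I" "finite F1" "h ` F1 = E" "\<one> \<in> F1"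
    using F0 E(3) by (auto simp: F1_def)
  have "\<exists>f'\<in>F1. \<exists>n\<in>I \<inter> ?N. \<exists>m\<in>M. s \<otimes> f = f' \<otimes> n \<otimes> m" if s: "s \<in> S" and f: "f \<in> F1" for s f
  proof -
    obtain f' m where fm: "f' \<in> F1" "m \<in> M" "h s \<otimes>\<^bsub>H\<^esub> h f = h f' \<otimes>\<^bsub>H\<^esub> h m"
      using E(4)[of "h s" "h f"] s f F(3) by blast
    have I: "s \<in> I" "f \<in> I" "f' \<in> I" "m \<in> I" using s f fm S F MI by auto
    define n where "n = inv (f' \<otimes> m) \<otimes> (s \<otimes> f)"
    have n: "n \<in> I" using I by (simp add: n_def)
    have "h n = \<one>\<^bsub>H\<^esub>"
      using I fm(3) by (simp add: n_def)
    then have "n \<in> I \<inter> ?N" using n by (simp add: kernel_def)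
    moreover obtain m' where m': "m' \<in> M" "m \<otimes> n = n \<otimes> m'" using swap fm(2) n by blast
    moreover have "s \<otimes> f = f' \<otimes> n \<otimes> m'"
    proof -
      have "s \<otimes> f = (f' \<otimes> m) \<otimes> n" using I by (simp add: n_def G.m_assoc[symmetric] del: G.inv_mult_group)
      then show ?thesis using I n m' by (simp add: G.m_assoc)
    qed
    ultimately show ?thesis using fm(1) by blast
  qed
  then obtain r c where rc: "\<And>s f. s \<in> S \<Longrightarrow> f \<in> F1 \<Longrightarrow> r s f \<in> F1 \<and> c s f \<in> I \<inter> ?N \<and> (\<exists>m\<in>M. s \<otimes> f = r s f \<otimes> c s f \<otimes> m)"
    by metis
  let ?S = "(\<lambda>(s, f). c s f) ` (S \<times> F1)"
  have "locally_finite_mod G (I \<inter> ?N) (M \<inter> ?N)"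
    using G.torsion_sections_locally_finite_restrict[OF N subgroup_kernel IM] .
  moreover have "finite ?S" "?S \<subseteq> I \<inter> ?N" using rc S(1) F(2) by auto
  ultimately obtain L where L: "finite L" "L \<subseteq> I \<inter> ?N" "\<one> \<in> L"
    "\<And>s f. s \<in> ?S \<Longrightarrow> f \<in> L \<Longrightarrow> \<exists>f'\<in>L. \<exists>m\<in>M \<inter> ?N. s \<otimes> f = f' \<otimes> m"
    by (metis locally_finite_modE)
  let ?F = "(\<lambda>(f, l). f \<otimes> l) ` (F1 \<times> L)"
  have "\<exists>f'\<in>?F. \<exists>m\<in>M. s \<otimes> (f \<otimes> l) = f' \<otimes> m" if s: "s \<in> S" and f: "f \<in> F1" and l: "l \<in> L" for s f l
  proof -
    obtain m where m: "m \<in> M" "s \<otimes> f = r s f \<otimes> c s f \<otimes> m" using rc s f by blast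
    obtain m1 where m1: "m1 \<in> M" "m \<otimes> l = l \<otimes> m1" using swap m(1) l L(2) by blast
    have "c s f \<in> ?S" using s f by (intro image_eqI[of _ _ "(s, f)"]) auto
    then obtain l' m2 where m2: "l' \<in> L" "m2 \<in> M" "c s f \<otimes> l = l' \<otimes> m2"
      using L(4)[of "c s f" l] l by auto
    have I: "s \<in> I" "f \<in> I" "l \<in> I" "l' \<in> I" "m \<in> I" "m1 \<in> I" "m2 \<in> I" "r s f \<in> I" "c s f \<in> I"
      using s f l m2 m m1 S F MI rc L(2) by auto
    have "s \<otimes> (f \<otimes> l) = (s \<otimes> f) \<otimes> l" using I by (simp add: G.m_assoc)
    also have "\<dots> = r s f \<otimes> c s f \<otimes> (m \<otimes> l)" using I m(2) by (simp add: G.m_assoc)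
    also have "\<dots> = r s f \<otimes> (c s f \<otimes> l) \<otimes> m1" using I m1(2) by (simp add: G.m_assoc)
    also have "\<dots> = (r s f \<otimes> l') \<otimes> (m2 \<otimes> m1)" using I m2(3) by (simp add: G.m_assoc)
    finally show ?thesis using rc[OF s f] m2 m1 by blast
  qed
  moreover have "\<one> \<in> ?F" using F L by (intro image_eqI[of _ _ "(\<one>, \<one>)"]) auto
  moreover have "?F \<subseteq> I" using F(1) L(2) by auto
  ultimately show "\<exists>F. finite F \<and> F \<subseteq> I \<and> \<one> \<in> F \<and>
      (\<forall>s\<in>S. \<forall>f\<in>F. \<exists>f'\<in>F. \<exists>m\<in>M. s \<otimes> f = f' \<otimes> m)"
    using F(2) L(1) by (intro exI[of _ ?F]) auto
qed (rule G.is_group)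

text \<open>
  Turns the quotients in the definition of elementary amenability, which are given up to an
  isomorphism onto a group on the original type, into surjective homomorphisms.
\<close>

lemma (in normal) quotient_projection:
  assumes "G Mod H \<cong> Q" and "group Q"
  obtains \<pi> where "group_hom G Q \<pi>" "\<pi> ` carrier G = carrier Q" "kernel G Q \<pi> = H"
proof -
  obtain \<phi> where \<phi>: "\<phi> \<in> iso (G Mod H) Q" using assms(1) unfolding is_iso_def by blast
  have grp: "group (G Mod H)" by (rule factorgroup_is_group)
  have "\<phi> \<circ> (\<lambda>a. H #> a) \<in> hom G Q"
    using Group.hom_compose[OF r_coset_hom_Mod iso_imp_homomorphism[OF \<phi>]] .
  then have "group_hom G Q (\<phi> \<circ> (\<lambda>a. H #> a))"
    using assms(2) by (simp add: group_hom_def group_hom_axioms_def)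
  moreover have "(\<phi> \<circ> (\<lambda>a. H #> a)) ` carrier G = carrier Q"
    using \<phi> by (simp only: image_comp[symmetric] carrier_FactGroup[symmetric] iso_iff)
  moreover have "kernel G Q (\<phi> \<circ> (\<lambda>a. H #> a)) = H"
  proof -
    have "\<phi> (H #> a) = \<one>\<^bsub>Q\<^esub> \<longleftrightarrow> H #> a = H" if "a \<in> carrier G" for a
    proof -
      have "\<phi> H = \<one>\<^bsub>Q\<^esub>"
        using hom_one[OF iso_imp_homomorphism[OF \<phi>] grp assms(2)] by simp
      moreover have "H #> a \<in> carrier (G Mod H)" "H \<in> carrier (G Mod H)"
        using that monoid.one_closed[OF group.is_monoid[OF grp]] by (simp_all add: carrier_FactGroup)
      moreover have "inj_on \<phi> (carrier (G Mod H))" using \<phi> by (simp add: iso_iff)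
      ultimately show ?thesis by (metis inj_onD)
    qed
    moreover have "H #> a = H \<longleftrightarrow> a \<in> H" if "a \<in> carrier G" for a
      using that coset_join1[OF _ that subgroup_axioms] coset_join2[OF that subgroup_axioms] by blast
    ultimately have "kernel G Q (\<phi> \<circ> (\<lambda>a. H #> a)) = {a \<in> carrier G. a \<in> H}"
      unfolding kernel_def o_def by blast
    then show ?thesis using subset by blast
  qed
  ultimately show ?thesis by (rule that)
qed

lemma elementary_amenable_torsion_sections_locally_finite:
  "elementary_amenable G \<Longrightarrow> torsion_sections_locally_finite G"
proof (induction rule: elementary_amenable.induct)
  case (abelian G)
  then show ?case by (rule comm_group.torsion_sections_locally_finite_abelian)
next
  case (finite G)
  then show ?case by (rule group.torsion_sections_locally_finite_finite)
next
  case (isomorphic G H)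
  then obtain \<phi> where \<phi>: "\<phi> \<in> iso G H" unfolding is_iso_def by blast
  have "group G" using isomorphic.IH unfolding torsion_sections_locally_finite_def by blast
  moreover have iso: "\<phi> \<in> hom G H" "\<phi> ` carrier G = carrier H"
    using \<phi> unfolding iso_iff by blast+
  ultimately have "group_hom G H \<phi>"
    using \<open>group H\<close> by (intro group_hom.intro group_hom_axioms.intro)
  then show ?case
    using isomorphic.IH iso(2) by (rule group_hom.torsion_sections_locally_finite_image)
next
  case (subgroup G H)
  have G: "group G" using subgroup.IH unfolding torsion_sections_locally_finite_def by blast
  have "group (G\<lparr>carrier := H\<rparr>)" using group.subgroup_imp_group[OF G subgroup.hyps(2)] .
  with subgroup.IH show ?case
    unfolding torsion_sections_locally_finite_def locally_finite_mod_restrict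
      group.torsion_section_restrict[OF G subgroup.hyps(2)] by blast
next
  case (quotient G N Q)
  obtain \<pi> where \<pi>: "group_hom G Q \<pi>" "\<pi> ` carrier G = carrier Q"
    using normal.quotient_projection[OF quotient.hyps(2,4,3)] by blast
  show ?case
    using \<pi>(1) quotient.IH \<pi>(2) by (rule group_hom.torsion_sections_locally_finite_image)
next
  case (extension G N Q)
  have "group Q" using extension.IH(2) unfolding torsion_sections_locally_finite_def by blast
  then obtain \<pi> where \<pi>: "group_hom G Q \<pi>" "kernel G Q \<pi> = N"
    using normal.quotient_projection[OF extension.hyps(2,4)] by blast
  show ?case
    using group_hom.torsion_sections_locally_finite_extension[OF \<pi>(1)] \<pi>(2) extension.IH by simp
next
  case (directed_union G \<H>)
  show ?case
    using directed_union.hyps(1)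
    by (rule group.torsion_sections_locally_finite_directed_union) (fact directed_union)+
qed

text \<open>
  The elements that map \<open>F\<close> into itself by left multiplication form a subgroup, because an
  injective map of a finite set into itself is onto, and they are contained in \<open>F\<close>, because
  \<open>\<one> \<in> F\<close>.
\<close>

lemma (in group) finite_subset_in_finite_subgroup:
  assumes "locally_finite_mod G (carrier G) {\<one>}" and S: "finite S" "S \<subseteq> carrier G"
  obtains K where "subgroup K G" "finite K" "S \<subseteq> K"
proof -
  obtain F where F: "finite F" "F \<subseteq> carrier G" "\<one> \<in> F"
    "\<And>s f. s \<in> S \<Longrightarrow> f \<in> F \<Longrightarrow> \<exists>f'\<in>F. \<exists>m\<in>{\<one>}. s \<otimes> f = f' \<otimes> m"
    by (rule locally_finite_modE[OF assms]) blast
  define K where "K = {g \<in> carrier G. \<forall>f\<in>F. g \<otimes> f \<in> F}"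
  have "s \<otimes> f \<in> F" if "s \<in> S" "f \<in> F" for s f
    using F(2) F(4)[OF that] by auto
  then have SK: "S \<subseteq> K" using S by (auto simp: K_def)
  have KF: "K \<subseteq> F" using F(3) by (force simp: K_def)
  have "subgroup K G"
  proof (rule subgroupI)
    show "inv a \<in> K" if a: "a \<in> K" for a
    proof -
      have aG: "a \<in> carrier G" using a by (simp add: K_def)
      have "inj_on (\<lambda>f. a \<otimes> f) F" using aG F(2) by (intro inj_onI) (metis Units_eq Units_l_cancel subsetD)
      moreover have "(\<lambda>f. a \<otimes> f) ` F \<subseteq> F" using a by (auto simp: K_def)
      ultimately have img: "(\<lambda>f. a \<otimes> f) ` F = F" using F(1) endo_inj_surj by blast
      have "inv a \<otimes> f \<in> F" if f: "f \<in> F" for f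
      proof -
        obtain f' where "f' \<in> F" "f = a \<otimes> f'" using img f by blast
        then show ?thesis using aG F(2) by (auto simp: m_assoc[symmetric])
      qed
      then show ?thesis using aG by (simp add: K_def)
    qed
    show "a \<otimes> b \<in> K" if "a \<in> K" "b \<in> K" for a b
      using that F(2) by (auto simp: K_def m_assoc)
    show "K \<noteq> {}" using F(2) by (auto simp: K_def intro!: exI[of _ \<one>])
  qed (auto simp: K_def)
  then show ?thesis using that finite_subset[OF KF F(1)] SK by blast
qed

section \<open>The bar complex\<close>

lemma length_bar_face:
  assumes "i \<le> length xs" "xs \<noteq> []"
  shows "length (bar_face G i xs) = length xs - 1"
  using assms by (auto simp: bar_face_def min_def)

text \<open>
  One formula covers inner and outer faces, so that the simplicial identity below becomes a
  comparison of entries.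
\<close>

lemma nth_bar_face:
  assumes "i \<le> length xs" "Suc k < length xs"
  shows "bar_face G i xs ! k =
    (if Suc k < i then xs ! k else if Suc k = i then xs ! k \<otimes>\<^bsub>G\<^esub> xs ! Suc k else xs ! Suc k)"
  using assms by (auto simp: bar_face_def nth_tl nth_butlast nth_append min_def)

lemma (in monoid) set_bar_face:
  assumes "set xs \<subseteq> carrier G" "i \<le> length xs"
  shows "set (bar_face G i xs) \<subseteq> carrier G"
proof (cases "xs = []")
  case True
  then show ?thesis using assms by (simp add: bar_face_def)
next
  case False
  show ?thesis
  proof
    fix x assume "x \<in> set (bar_face G i xs)"
    then obtain k where "k < length (bar_face G i xs)" and x: "x = bar_face G i xs ! k"
      by (auto simp: in_set_conv_nth)
    then have k: "Suc k < length xs" using length_bar_face[OF assms(2) False, of G] by simp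
    have "xs ! k \<in> carrier G" "xs ! Suc k \<in> carrier G" using assms(1) k by auto
    then show "x \<in> carrier G" unfolding x nth_bar_face[OF assms(2) k] by auto
  qed
qed

lemma (in monoid) bar_face_bar_face:
  assumes xs: "set xs \<subseteq> carrier G" and ij: "i < j" "j \<le> length xs" and len: "2 \<le> length xs"
  shows "bar_face G i (bar_face G j xs) = bar_face G (j - 1) (bar_face G i xs)"
proof (rule nth_equalityI)
  have ne: "xs \<noteq> []" using len by auto
  have lenj: "length (bar_face G j xs) = length xs - 1" and leni: "length (bar_face G i xs) = length xs - 1"
    using ij ne by (simp_all add: length_bar_face)
  have ne': "bar_face G j xs \<noteq> []" "bar_face G i xs \<noteq> []"
    using len lenj leni by (metis list.size(3) diff_is_0_eq not_less_eq_eq numeral_2_eq_2 One_nat_def)+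
  show "length (bar_face G i (bar_face G j xs)) = length (bar_face G (j - 1) (bar_face G i xs))"
    using ij ne' by (simp add: length_bar_face lenj leni)
  fix k assume "k < length (bar_face G i (bar_face G j xs))"
  then have k: "Suc (Suc k) < length xs"
    using ij ne' by (simp add: length_bar_face lenj)
  have car: "xs ! l \<in> carrier G" if "l < length xs" for l using xs that by auto
  have "bar_face G i (bar_face G j xs) ! k =
      (if Suc k < i then bar_face G j xs ! k
       else if Suc k = i then bar_face G j xs ! k \<otimes> bar_face G j xs ! Suc k
       else bar_face G j xs ! Suc k)"
    using ij k lenj by (intro nth_bar_face) auto
  moreover have "bar_face G (j - 1) (bar_face G i xs) ! k =
      (if Suc k < j - 1 then bar_face G i xs ! k
       else if Suc k = j - 1 then bar_face G i xs ! k \<otimes> bar_face G i xs ! Suc k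
       else bar_face G i xs ! Suc k)"
    using ij k leni by (intro nth_bar_face) auto
  ultimately show "bar_face G i (bar_face G j xs) ! k = bar_face G (j - 1) (bar_face G i xs) ! k"
    using ij k by (auto simp: nth_bar_face m_assoc car)
qed

lemma bar_boundary_add: "bar_boundary n G (a + b) = bar_boundary n G a + bar_boundary n G b"
  by (simp add: bar_boundary_def frag_extend_add)

lemma bar_boundary_minus: "bar_boundary n G (- a) = - bar_boundary n G a"
  by (simp add: bar_boundary_def frag_extend_minus)

lemma bar_boundary_diff: "bar_boundary n G (a - b) = bar_boundary n G a - bar_boundary n G b"
  by (simp add: bar_boundary_def frag_extend_diff)

lemma bar_boundary_cmul: "bar_boundary n G (frag_cmul k a) = frag_cmul k (bar_boundary n G a)"
  by (simp add: bar_boundary_def frag_extend_cmul)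

lemma bar_boundary_zero [simp]: "bar_boundary n G 0 = 0"
  by (simp add: bar_boundary_def)

lemma bar_boundary_sum: "bar_boundary n G (sum f I) = (\<Sum>i\<in>I. bar_boundary n G (f i))"
  by (induction I rule: infinite_finite_induct) (simp_all add: bar_boundary_add)

lemma bar_boundary_frag_of:
  "n \<noteq> 0 \<Longrightarrow> bar_boundary n G (frag_of xs) =
     (\<Sum>i\<le>n. frag_cmul ((-1) ^ i) (frag_of (bar_face G i xs)))"
  by (simp add: bar_boundary_def)

lemma carrier_bar_chain_group:
  "c \<in> carrier (bar_chain_group n G) \<longleftrightarrow>
     Poly_Mapping.keys c \<subseteq> {xs. length xs = n \<and> set xs \<subseteq> carrier G}"
  by (simp add: bar_chain_group_def)

lemma (in monoid) bar_boundary_closed: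
  assumes "c \<in> carrier (bar_chain_group (Suc n) G)"
  shows "bar_boundary (Suc n) G c \<in> carrier (bar_chain_group n G)"
proof -
  have "Poly_Mapping.keys (\<Sum>i\<le>Suc n. frag_cmul ((-1) ^ i) (frag_of (bar_face G i xs)))
      \<subseteq> {xs. length xs = n \<and> set xs \<subseteq> carrier G}"
    if "xs \<in> Poly_Mapping.keys c" for xs
  proof -
    have xs: "length xs = Suc n" "set xs \<subseteq> carrier G"
      using assms that by (auto simp: carrier_bar_chain_group)
    have "xs \<noteq> []" using xs(1) by auto
    then have "length (bar_face G i xs) = n \<and> set (bar_face G i xs) \<subseteq> carrier G" if "i \<le> Suc n" for i
      using xs that length_bar_face[of i xs G] set_bar_face[of xs i] by simp
    then show ?thesis by (intro order_trans[OF keys_sum] UN_least order_trans[OF keys_cmul]) simp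
  qed
  then show ?thesis
    unfolding carrier_bar_chain_group bar_boundary_def
    by (simp only: Suc_not_Zero if_False) (intro order_trans[OF keys_frag_extend] UN_least)
qed

text \<open>
  In the double sum over the faces \<open>i\<close> of the faces \<open>j\<close>, the terms with \<open>i < j\<close> and those with
  \<open>j \<le> i\<close> cancel in pairs by the simplicial identity.
\<close>

lemma (in monoid) bar_boundary_bar_boundary:
  assumes n: "n \<noteq> 0" and c: "c \<in> carrier (bar_chain_group (Suc n) G)"
  shows "bar_boundary n G (bar_boundary (Suc n) G c) = 0"
proof -
  have gen: "bar_boundary n G (bar_boundary (Suc n) G (frag_of xs)) = 0"
    if xs: "length xs = Suc n" "set xs \<subseteq> carrier G" for xs
  proof -
    define t where "t j i = frag_cmul ((-1) ^ (i + j)) (frag_of (bar_face G i (bar_face G j xs)))" for i j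
    let ?L = "{(j, i). j \<le> Suc n \<and> i < j}" and ?U = "{(j, i). i \<le> n \<and> j \<le> i}"
    have split: "{..Suc n} \<times> {..n} = ?L \<union> ?U" "?L \<inter> ?U = {}" by auto
    have fin: "finite ?L" "finite ?U"
      by (rule finite_subset[of _ "{..Suc n} \<times> {..n}"]; auto)+
    have "bar_boundary n G (bar_boundary (Suc n) G (frag_of xs)) = (\<Sum>j\<le>Suc n. \<Sum>i\<le>n. t j i)"
      by (simp only: bar_boundary_frag_of n bar_boundary_sum bar_boundary_cmul frag_cmul_sum
          frag_cmul_cmul t_def power_add mult.commute Suc_not_Zero not_False_eq_True simp_thms)
    also have "\<dots> = (\<Sum>(j, i)\<in>?L. t j i) + (\<Sum>(j, i)\<in>?U. t j i)"
      unfolding sum.cartesian_product split(1) using fin split(2) by (rule sum.union_disjoint)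
    also have "(\<Sum>(j, i)\<in>?L. t j i) = (\<Sum>(j, i)\<in>?U. - t j i)"
    proof (rule sum.reindex_bij_witness[of _ "\<lambda>(j, i). (Suc i, j)" "\<lambda>(j, i). (i, j - 1)"])
      fix p assume "p \<in> ?L"
      then obtain j i where p: "p = (j, i)" "j \<le> Suc n" "i < j" by auto
      have "bar_face G i (bar_face G j xs) = bar_face G (j - 1) (bar_face G i xs)"
        using xs p n by (intro bar_face_bar_face) auto
      moreover have "(- 1 :: int) ^ (i + j) = - ((- 1) ^ (j - 1 + i))"
        using p(3) by (cases j) (simp_all add: add.commute)
      ultimately have "t j i = - t i (j - 1)" by (simp add: t_def)
      then show "(case case p of (j, i) \<Rightarrow> (i, j - 1) of (j, i) \<Rightarrow> - t j i) = (case p of (j, i) \<Rightarrow> t j i)"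
        by (simp add: p(1))
    qed auto
    finally show ?thesis by (simp add: sum_negf case_prod_unfold)
  qed
  show ?thesis
    using c unfolding carrier_bar_chain_group
    by (induction c rule: free_Abelian_group_induct[consumes 1, case_names zero diff single]) (auto simp: gen bar_boundary_diff)
qed

text \<open>
  For a finite group \<open>K\<close>, this is up to sign a chain homotopy, in positive degrees, from
  multiplication by the order of \<open>K\<close> to zero.
\<close>

definition append_sum :: "'a set \<Rightarrow> ('a list \<Rightarrow>\<^sub>0 int) \<Rightarrow> ('a list \<Rightarrow>\<^sub>0 int)" where
  "append_sum K = frag_extend (\<lambda>xs. \<Sum>g\<in>K. frag_of (xs @ [g]))"

lemma append_sum_closed:
  assumes "c \<in> carrier (bar_chain_group n G)" and "K \<subseteq> carrier G"
  shows "append_sum K c \<in> carrier (bar_chain_group (Suc n) G)"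
  unfolding carrier_bar_chain_group append_sum_def
proof (intro order_trans[OF keys_frag_extend] UN_least order_trans[OF keys_sum])
  fix xs g assume "xs \<in> Poly_Mapping.keys c" "g \<in> K"
  then show "Poly_Mapping.keys (frag_of (xs @ [g])) \<subseteq> {xs. length xs = Suc n \<and> set xs \<subseteq> carrier G}"
    using assms unfolding carrier_bar_chain_group by auto
qed

lemma append_sum_sum: "append_sum K (sum f I) = (\<Sum>i\<in>I. append_sum K (f i))"
  by (induction I rule: infinite_finite_induct) (simp_all add: append_sum_def frag_extend_add)

lemma frag_sum_constant: "(\<Sum>x\<in>A. c) = frag_cmul (int (card A)) c"
  by (induction A rule: infinite_finite_induct) (simp_all add: frag_cmul_distrib)

lemma frag_cmul_diff: "frag_cmul k (a - b) = frag_cmul k a - frag_cmul k b"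
  by (rule poly_mapping_eqI) (simp add: lookup_minus right_diff_distrib)

lemma bar_face_append:
  assumes "i < length xs"
  shows "bar_face G i (xs @ [g]) = bar_face G i xs @ [g]"
  using assms by (auto simp: bar_face_def nth_append)

lemma bar_face_length_append:
  "xs \<noteq> [] \<Longrightarrow> bar_face G (length xs) (xs @ [g]) = butlast xs @ [last xs \<otimes>\<^bsub>G\<^esub> g]"
  by (simp add: bar_face_def nth_append butlast_conv_take last_conv_nth)

lemma bar_face_Suc_length_append: "bar_face G (Suc (length xs)) (xs @ [g]) = xs"
  by (simp add: bar_face_def)

text \<open>
  All faces of \<open>[x\<^sub>1|\<dots>|x\<^sub>n|g]\<close> but the last two leave \<open>g\<close> alone and give the faces of
  \<open>[x\<^sub>1|\<dots>|x\<^sub>n]\<close> with \<open>g\<close> appended. The face \<open>n\<close> multiplies \<open>x\<^sub>n\<close> by \<open>g\<close>; summed over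
  \<open>g \<in> K\<close>, this is the same as dropping \<open>x\<^sub>n\<close> and appending \<open>g\<close>, which is the missing outer face.
  The face \<open>n + 1\<close> drops \<open>g\<close> and contributes \<open>[x\<^sub>1|\<dots>|x\<^sub>n]\<close> once for every \<open>g \<in> K\<close>.
\<close>

lemma (in group) bar_boundary_append_sum:
  assumes K: "subgroup K G" and n: "n \<noteq> 0"
    and c: "Poly_Mapping.keys c \<subseteq> {xs. length xs = n \<and> set xs \<subseteq> K}"
  shows "bar_boundary (Suc n) G (append_sum K c) =
    append_sum K (bar_boundary n G c) + frag_cmul ((-1) ^ Suc n * int (card K)) c"
  using c
proof (induction c rule: free_Abelian_group_induct[consumes 1, case_names zero diff single])
  case zero
  show ?case by (simp add: append_sum_def)
next
  case (diff x y)
  then show ?case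
    by (simp add: append_sum_def frag_extend_diff bar_boundary_diff frag_cmul_diff)
next
  case (single xs)
  then have xs: "length xs = n" "set xs \<subseteq> K" by auto
  have ne: "xs \<noteq> []" using xs n by auto
  have last: "last xs \<in> K" using xs ne by auto
  have KG: "x \<in> carrier G" if "x \<in> K" for x using K that by (rule subgroup.mem_carrier)
  let ?f = "\<lambda>i g. frag_cmul ((-1) ^ i) (frag_of (bar_face G i (xs @ [g])))"
  let ?h = "\<lambda>i g. frag_cmul ((-1) ^ i) (frag_of (bar_face G i xs @ [g]))"
  have "bar_boundary (Suc n) G (append_sum K (frag_of xs)) = (\<Sum>g\<in>K. \<Sum>i\<le>Suc n. ?f i g)"
    by (simp add: append_sum_def bar_boundary_sum bar_boundary_frag_of del: sum.atMost_Suc)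
  also have "\<dots> = (\<Sum>i\<le>Suc n. \<Sum>g\<in>K. ?f i g)" by (rule sum.swap)
  also have "\<dots> = (\<Sum>i<n. \<Sum>g\<in>K. ?f i g) + (\<Sum>g\<in>K. ?f n g) + (\<Sum>g\<in>K. ?f (Suc n) g)"
    by (simp add: lessThan_Suc_atMost[symmetric])
  also have "(\<Sum>i<n. \<Sum>g\<in>K. ?f i g) = (\<Sum>i<n. \<Sum>g\<in>K. ?h i g)"
    using xs by (simp add: bar_face_append)
  also have "(\<Sum>g\<in>K. ?f n g) = (\<Sum>g\<in>K. ?h n g)"
  proof -
    have "(\<Sum>g\<in>K. ?f n g) = (\<Sum>g\<in>K. frag_cmul ((-1) ^ n) (frag_of (butlast xs @ [last xs \<otimes> g])))"
      using bar_face_length_append[OF ne, of G] xs by simp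
    also have "\<dots> = (\<Sum>g\<in>K. frag_cmul ((-1) ^ n) (frag_of (butlast xs @ [g])))"
      by (rule sum.reindex_bij_witness[of _ "\<lambda>g. inv (last xs) \<otimes> g" "\<lambda>g. last xs \<otimes> g"])
         (use last KG K in \<open>auto simp: subgroup.m_closed subgroup.m_inv_closed m_assoc[symmetric]\<close>)
    also have "\<dots> = (\<Sum>g\<in>K. ?h n g)" using xs n by (simp add: bar_face_def)
    finally show ?thesis .
  qed
  also have "(\<Sum>g\<in>K. ?f (Suc n) g) = frag_cmul ((-1) ^ Suc n * int (card K)) (frag_of xs)"
    using bar_face_Suc_length_append[of G xs] xs by (simp add: frag_sum_constant mult.commute)
  also have "(\<Sum>i<n. \<Sum>g\<in>K. ?h i g) + (\<Sum>g\<in>K. ?h n g) = (\<Sum>i\<le>n. \<Sum>g\<in>K. ?h i g)"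
    by (simp add: lessThan_Suc_atMost[symmetric])
  also have "\<dots> = append_sum K (bar_boundary n G (frag_of xs))"
    unfolding bar_boundary_frag_of[OF n] append_sum_sum
    by (simp add: append_sum_def frag_extend_cmul frag_cmul_sum)
  finally show ?case .
qed

lemma (in group) card_cmul_bar_cycle_in_bar_boundaries:
  assumes K: "subgroup K G" and n: "n \<noteq> 0" and c: "c \<in> bar_cycles n G"
    and supp: "\<And>xs. xs \<in> Poly_Mapping.keys c \<Longrightarrow> set xs \<subseteq> K"
  shows "frag_cmul (int (card K)) c \<in> bar_boundaries n G"
proof -
  have chain: "c \<in> carrier (bar_chain_group n G)" and cycle: "bar_boundary n G c = 0"
    using c by (auto simp: bar_cycles_def)
  let ?b = "frag_cmul ((-1) ^ Suc n) (append_sum K c)"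
  have "Poly_Mapping.keys c \<subseteq> {xs. length xs = n \<and> set xs \<subseteq> K}"
    using chain supp unfolding carrier_bar_chain_group by auto
  then have "bar_boundary (Suc n) G ?b = frag_cmul (int (card K)) c"
    using bar_boundary_append_sum[OF K n] cycle
    by (simp add: bar_boundary_cmul append_sum_def power_mult_distrib[symmetric])
  moreover have "?b \<in> carrier (bar_chain_group (Suc n) G)"
    using append_sum_closed[OF chain subgroup.subset[OF K]] keys_cmul
    unfolding carrier_bar_chain_group by fast
  ultimately show ?thesis unfolding bar_boundaries_def by (metis imageI)
qed

lemma bar_cycles_subgroup: "subgroup (bar_cycles n G) (bar_chain_group n G)"
proof -
  interpret C: group "bar_chain_group n G" by (simp add: bar_chain_group_def)
  show ?thesis
  proof (rule C.subgroupI)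
    show "bar_cycles n G \<noteq> {}"
      by (auto simp: bar_cycles_def carrier_bar_chain_group intro!: exI[of _ 0])
    show "inv\<^bsub>bar_chain_group n G\<^esub> a \<in> bar_cycles n G" if "a \<in> bar_cycles n G" for a
      using that by (simp add: bar_cycles_def bar_chain_group_def bar_boundary_minus)
    show "a \<otimes>\<^bsub>bar_chain_group n G\<^esub> b \<in> bar_cycles n G"
      if "a \<in> bar_cycles n G" "b \<in> bar_cycles n G" for a b
      using that C.m_closed[of a b] by (simp add: bar_cycles_def bar_chain_group_def bar_boundary_add)
  qed (auto simp: bar_cycles_def)
qed

lemma (in monoid) bar_boundaries_subgroup: "subgroup (bar_boundaries n G) (bar_chain_group n G)"
proof -
  have "group_hom (bar_chain_group (Suc n) G) (bar_chain_group n G) (bar_boundary (Suc n) G)"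
    unfolding group_hom_def group_hom_axioms_def
    using bar_boundary_closed by (auto simp: hom_def bar_boundary_add bar_chain_group_def)
  then show ?thesis unfolding bar_boundaries_def by (rule group_hom.img_is_subgroup)
qed

lemma (in monoid) bar_boundaries_normal_bar_cycles:
  assumes "n \<noteq> 0"
  shows "bar_boundaries n G \<lhd> (bar_chain_group n G)\<lparr>carrier := bar_cycles n G\<rparr>"
proof -
  interpret C: comm_group "bar_chain_group n G"
    unfolding bar_chain_group_def by (rule abelian_free_Abelian_group)
  interpret Z: comm_group "(bar_chain_group n G)\<lparr>carrier := bar_cycles n G\<rparr>"
    using C.subgroup_imp_group[OF bar_cycles_subgroup]
    by (rule group.group_comm_groupI) (simp add: bar_chain_group_def add.commute)
  have "bar_boundaries n G \<subseteq> bar_cycles n G"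
    using assms bar_boundary_closed bar_boundary_bar_boundary
    by (auto simp: bar_boundaries_def bar_cycles_def)
  then show ?thesis
    by (intro Z.subgroup_imp_normal C.subgroup_incl bar_boundaries_subgroup bar_cycles_subgroup)
qed

lemma (in monoid) group_group_homology:
  "n \<noteq> 0 \<Longrightarrow> group (group_homology n G)"
  unfolding group_homology_def
  using bar_boundaries_normal_bar_cycles by (rule normal.factorgroup_is_group)

text \<open>
  A cycle involves only finitely many elements of \<open>G\<close>, hence lives on a finite subgroup \<open>K\<close> and
  its class is the image of a class of \<open>K\<close>, which is annihilated by the order of \<open>K\<close>.
\<close>

lemma (in group) ord_group_homology_dvd_card_finite_subgroup:
  assumes n: "n \<noteq> 0" and x: "x \<in> carrier (group_homology n G)"
    and fin: "\<And>S. finite S \<Longrightarrow> S \<subseteq> carrier G \<Longrightarrow> \<exists>K. subgroup K G \<and> finite K \<and> S \<subseteq> K"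
  obtains K where "subgroup K G" "finite K" "group.ord (group_homology n G) x dvd card K"
proof -
  let ?Z = "(bar_chain_group n G)\<lparr>carrier := bar_cycles n G\<rparr>"
  interpret B: normal "bar_boundaries n G" ?Z using n by (rule bar_boundaries_normal_bar_cycles)
  interpret H: group "group_homology n G" using n by (rule group_group_homology)
  obtain c where c: "c \<in> bar_cycles n G" "x = bar_boundaries n G #>\<^bsub>?Z\<^esub> c"
    using x by (auto simp: group_homology_def carrier_FactGroup)
  let ?S = "\<Union>xs\<in>Poly_Mapping.keys c. set xs"
  have "?S \<subseteq> carrier G" using c(1) by (auto simp: bar_cycles_def carrier_bar_chain_group)
  then obtain K where K: "subgroup K G" "finite K" "?S \<subseteq> K" using fin[of ?S] by auto
  have pow: "c [^]\<^bsub>?Z\<^esub> card K = frag_cmul (int (card K)) c"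
    using pow_free_Abelian_group[of _ c "card K"] by (simp add: nat_pow_def bar_chain_group_def)
  have mem: "frag_cmul (int (card K)) c \<in> bar_boundaries n G"
    using K n c(1) by (intro card_cmul_bar_cycle_in_bar_boundaries) auto
  have "x [^]\<^bsub>group_homology n G\<^esub> card K = bar_boundaries n G #>\<^bsub>?Z\<^esub> frag_cmul (int (card K)) c"
    unfolding group_homology_def c(2) using c(1) B.FactGroup_pow[of c "card K"] pow by simp
  also have "\<dots> = \<one>\<^bsub>group_homology n G\<^esub>"
    using mem B.rcos_const[OF B.is_group mem] by (simp add: group_homology_def)
  finally have "group.ord (group_homology n G) x dvd card K" using H.pow_eq_id x by simp
  then show ?thesis using that K by blast
qed

section \<open>Torsion in group homology\<close>

text \<open>
  For a prime divisor \<open>p\<close> of the order of \<open>K\<close>, any element other than \<open>\<one>\<close> of a subgroup of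
  order \<open>p\<close> has order \<open>p\<close>, so \<open>p \<in> P\<close>.
\<close>

lemma (in group) prime_factors_finite_subgroup_of_P_torsion:
  assumes P: "P_torsion_group P G" and K: "subgroup K G" "finite K"
  shows "prime_factors (card K) \<subseteq> P"
proof
  fix p assume "p \<in> prime_factors (card K)"
  then have p: "prime p" "p dvd card K" by (auto simp: in_prime_factors_iff)
  interpret GK: group "G\<lparr>carrier := K\<rparr>" using K(1) by (rule subgroup_imp_group)
  obtain m where "order (G\<lparr>carrier := K\<rparr>) = p ^ 1 * m" using p(2) by (auto simp: order_def)
  then obtain C where C: "subgroup C (G\<lparr>carrier := K\<rparr>)" "card C = p ^ 1"
    using sylow_thm[OF p(1) GK.is_group, of 1 m] K(2) by auto
  have CG: "subgroup C G" using incl_subgroup[OF K(1) C(1)] .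
  interpret GC: group "G\<lparr>carrier := C\<rparr>" using CG by (rule subgroup_imp_group)
  have "card C > 1" using C(2) prime_gt_1_nat[OF p(1)] by simp
  then have "\<not> C \<subseteq> {\<one>}" using card_mono[of "{\<one>}" C] by auto
  then obtain x where x: "x \<in> C" "x \<noteq> \<one>" by blast
  have xG: "x \<in> carrier G" using x(1) CG subgroup.mem_carrier by metis
  have "x [^] p = \<one>"
    using GC.pow_order_eq_1[of x] x(1) C(2) nat_pow_consistent[of x p C] by (simp add: order_def)
  then have "ord x dvd p" using pow_eq_id xG by simp
  moreover have "ord x \<noteq> 1" using ord_eq_1[OF xG] x(2) by simp
  ultimately have "ord x = p" using p(1) prime_nat_iff by blast
  then show "p \<in> P" using P xG p(1) unfolding P_torsion_group_def
    by (auto simp: prime_factorization_prime)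
qed

theorem proposition4p3:
  fixes P :: "nat set" and G :: "'a monoid" and n :: nat
  assumes "P \<noteq> {}" and "\<forall>p\<in>P. prime p"
    and "elementary_amenable G" and "P_torsion_group P G"
    and "n \<ge> 1"
  shows "P_torsion_group P (group_homology n G)"
proof -
  interpret group G using assms(4) unfolding P_torsion_group_def by blast
  have n: "n \<noteq> 0" using assms(5) by simp
  have "\<exists>k>0. h [^]\<^bsub>G\<^esub> (k::nat) = \<one>\<^bsub>G\<^esub>" if "h \<in> carrier G" for h
    using assms(4) that pow_ord_eq_1 unfolding P_torsion_group_def by blast
  then have "torsion_section G (carrier G) {\<one>\<^bsub>G\<^esub>}"
    using subgroup_self triv_subgroup by (simp add: torsion_section_def)
  then have lf: "locally_finite_mod G (carrier G) {\<one>\<^bsub>G\<^esub>}"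
    using elementary_amenable_torsion_sections_locally_finite[OF assms(3)]
    unfolding torsion_sections_locally_finite_def by blast
  have fin: "\<exists>K. subgroup K G \<and> finite K \<and> S \<subseteq> K" if "finite S" "S \<subseteq> carrier G" for S
    using finite_subset_in_finite_subgroup[OF lf that] by blast
  let ?H = "group_homology n G"
  have "group.ord ?H x \<noteq> 0 \<and> prime_factors (group.ord ?H x) \<subseteq> P" if x: "x \<in> carrier ?H" for x
  proof -
    obtain K where K: "subgroup K G" "finite K" "group.ord ?H x dvd card K"
      using ord_group_homology_dvd_card_finite_subgroup[OF n x fin] by blast
    have "card K \<noteq> 0" using K(2) subgroup.one_closed[OF K(1)] by auto
    then have "group.ord ?H x \<noteq> 0" "prime_factors (group.ord ?H x) \<subseteq> prime_factors (card K)"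
      using K(3) by (auto simp: dvd_prime_factors)
    then show ?thesis
      using prime_factors_finite_subgroup_of_P_torsion[OF assms(4) K(1,2)] by blast
  qed
  then show ?thesis unfolding P_torsion_group_def using group_group_homology[OF n] by blast
qed

end
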